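(* Let $\mathbb{X}$ be a finite dimensional real inner product space with induced norm $\|\cdot\|$, and let $\Phi:\mathbb{X}\to(-\infty,\infty]$ be a proper lower semicontinuous function that is coercive and bounded below. Let $m\ge 0$ be an integer, $a>0$, $b>0$, and let $\{x^k\}_{k\in\mathbb{N}}\subset\mathbb{X}$ be a sequence such that for each $k\in\mathbb{N}$: (H1) $\Phi(x^{k+1})+a\|x^{k+1}-x^k\|^2\le\max_{j=[k-m]_+,\ldots,k}\Phi(x^j)$; (H2) there exists $w^k\in\partial\Phi(x^k)$ such that $\|w^{k+1}\|\le b\|x^{k+1}-x^k\|$. Let $\omega(x^0)$ be the set of cluster points of $\{x^k\}_{k\in\mathbb{N}}$. Suppose that $\Phi$ is a KL function, that $\liminf_{k\to\infty}\Phi(x^k)\ge\lim_{k\to\infty}\Phi(x^{\ell(k)})$, and that $\limsup_{j\to\infty}\Phi(x^{k_j})\le\Phi(\widehat{x})$ for each subsequence $\{x^{k_j}\}_{j\in\mathbb{N}}$ with $\lim_{j\to\infty}x^{k_j}=\widehat{x}$. Suppose that there exist a constant $a_0\in\big[0,\frac{a}{8(m+1)^2}\big]$ and a neighborhood $\mathcal{N}_0$ of $\omega(x^0)$ such that $$\mathrm{dist}(0,\partial\Phi(z))\,\|y-z\|+a_0\|y-z\|^2\ge\Phi(z)-\Phi(y)\qquad\forall\, y,z\in\mathcal{N}_0\setminus\omega(x^0).$$ Then, with $K_1:=\big\{k\in\mathbb{N}\,|\,\Phi(x^{\ell(k+1)})-\Phi(x^{k+1})\ge\frac{a}{2}\|x^{k+1}-x^k\|^2\big\}$,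 it holds that $$\sum_{k\in K_1}\sqrt{\Phi(x^{\ell(k+1)})-\Phi(x^{k+1})}<\infty\quad\text{whenever}\quad\liminf_{K_1\ni k\to\infty}\frac{\Phi(x^{\ell(k)})-\Phi(x^{\ell(k+1)})}{\|x^{k+1}-x^k\|^2}=0 .$$
   Context: $[t]_+:=\max(0,t)$. For each $k$, $\ell(k)$ denotes the largest index in $\arg\max_{j=[k-m]_+,\ldots,k}\Phi(x^j)$ (under (H1), $\{\Phi(x^{\ell(k)})\}$ is nonincreasing, so its limit exists). $\partial\Phi$ denotes the limiting (Mordukhovich) subdifferential; it is considered only at points of $\mathrm{dom}\,\Phi$ (and taken empty elsewhere); $\mathrm{dist}(0,\emptyset)=+\infty$, and the displayed inequality on $\mathcal{N}_0\setminus\omega(x^0)$ is regarded as satisfied when $\partial\Phi(z)=\emptyset$. KL property: for $\eta\in(0,\infty]$, let $\Upsilon_\eta$ be the family of continuous concave $\varphi:[0,\eta)\to\mathbb{R}_+$ that are continuously differentiable on $(0,\eta)$ with $\varphi'>0$ there and $\varphi(0)=0$. A proper lsc $h$ has the KL property at $\overline{x}\in\mathrm{dom}\,\partial h$ if there exist $\eta\in(0,\infty]$, a neighborhood $\mathcal{U}$ of $\overline{x}$ and $\varphi\in\Upsilon_\eta$ such that $\varphi'(h(x)-h(\overline{x}))\,\mathrm{dist}(0,\partial h(x))\ge1$ for all $x\in\mathcal{U}$ with $h(\overline{x})<h(x)<h(\overline{x})+\eta$. $h$ is a KL function if it has the KL property at every point of $\mathrm{dom}\,\partial h$. Convention: the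 quotient with denominator $\|x^{k+1}-x^k\|^2$ is read as $+\infty$ when $x^{k+1}=x^k$, and a liminf over a finite index set is $+\infty$. *)

theory Defs
  imports "HOL-Analysis.Analysis"
begin

definition proper_fun :: "('a \<Rightarrow> ereal) \<Rightarrow> bool" where
  "proper_fun h \<longleftrightarrow> (\<forall>x. h x \<noteq> -\<infinity>) \<and> (\<exists>x. h x \<noteq> \<infinity>)"

definition lsc_fun :: "('a::topological_space \<Rightarrow> ereal) \<Rightarrow> bool" where
  "lsc_fun h \<longleftrightarrow> (\<forall>x. h x \<le> Liminf (at x) h)"

definition coercive_fun :: "('a::real_normed_vector \<Rightarrow> ereal) \<Rightarrow> bool" where
  "coercive_fun h \<longleftrightarrow> (h \<longlongrightarrow> \<infinity>) at_infinity"

definition bounded_below_fun :: "('a \<Rightarrow> ereal) \<Rightarrow> bool" where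
  "bounded_below_fun h \<longleftrightarrow> (\<exists>c::real. \<forall>x. ereal c \<le> h x)"

definition regular_subdiff :: "('a::euclidean_space \<Rightarrow> ereal) \<Rightarrow> 'a \<Rightarrow> 'a set" where
  "regular_subdiff h x =
     {v. \<bar>h x\<bar> \<noteq> \<infinity> \<and>
         0 \<le> Liminf (at x) (\<lambda>y. (h y - h x - ereal (inner v (y - x))) / ereal (norm (y - x)))}"

text \<open>The limiting (Mordukhovich) subdifferential. It is empty at points where the function
  is not finite.\<close>

definition limiting_subdiff :: "('a::euclidean_space \<Rightarrow> ereal) \<Rightarrow> 'a \<Rightarrow> 'a set" where
  "limiting_subdiff h x =
     {v. \<bar>h x\<bar> \<noteq> \<infinity> \<and>
         (\<exists>u w. (\<forall>k::nat. w k \<in> regular_subdiff h (u k)) \<and>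
                u \<longlonglongrightarrow> x \<and> (\<lambda>k. h (u k)) \<longlonglongrightarrow> h x \<and> w \<longlonglongrightarrow> v)}"

text \<open>The library functions \<open>infdist\<close> and \<open>setdist\<close> are real-valued and return 0 for the
  empty set; here the distance to the empty set is \<open>\<infinity>\<close>.\<close>

definition edist :: "'a::metric_space \<Rightarrow> 'a set \<Rightarrow> ereal" where
  "edist x S = (INF y\<in>S. ereal (dist x y))"

text \<open>Functions on \<open>[0, \<eta>)\<close> are represented by total functions on the reals whose values
  outside that interval are irrelevant.\<close>

definition KL_desingularizers :: "ereal \<Rightarrow> (real \<Rightarrow> real) set" where
  "KL_desingularizers \<eta> =
     {\<phi>. continuous_on {t. 0 \<le> t \<and> ereal t < \<eta>} \<phi> \<and>
          concave_on {t. 0 \<le> t \<and> ereal t < \<eta>} \<phi> \<and>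
          (\<forall>t. 0 \<le> t \<and> ereal t < \<eta> \<longrightarrow> 0 \<le> \<phi> t) \<and>
          \<phi> C1_differentiable_on {t. 0 < t \<and> ereal t < \<eta>} \<and>
          (\<forall>t. 0 < t \<and> ereal t < \<eta> \<longrightarrow> 0 < deriv \<phi> t) \<and>
          \<phi> 0 = 0}"

text \<open>In the inequality below, \<open>h x\<close> and \<open>h xbar\<close> are both finite, so that \<open>real_of_ereal\<close>
  is the genuine value of the difference.\<close>

definition KL_property_at :: "('a::euclidean_space \<Rightarrow> ereal) \<Rightarrow> 'a \<Rightarrow> bool" where
  "KL_property_at h xbar \<longleftrightarrow>
     (\<exists>\<eta> U \<phi>. 0 < \<eta> \<and> open U \<and> xbar \<in> U \<and> \<phi> \<in> KL_desingularizers \<eta> \<and>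
        (\<forall>x\<in>U. h xbar < h x \<and> h x < h xbar + \<eta> \<longrightarrow>
           1 \<le> ereal (deriv \<phi> (real_of_ereal (h x - h xbar))) * edist 0 (limiting_subdiff h x)))"

definition KL_function :: "('a::euclidean_space \<Rightarrow> ereal) \<Rightarrow> bool" where
  "KL_function h \<longleftrightarrow> (\<forall>xbar. limiting_subdiff h xbar \<noteq> {} \<longrightarrow> KL_property_at h xbar)"

definition cluster_points :: "(nat \<Rightarrow> 'a::topological_space) \<Rightarrow> 'a set" where
  "cluster_points x = {z. \<exists>r. strict_mono r \<and> (x \<circ> r) \<longlonglongrightarrow> z}"

text \<open>The largest index in the argmax of \<open>f\<close> over the window \<open>{[k - m]\<^sub>+, ..., k}\<close>; truncated
  subtraction of natural numbers is the positive part.\<close>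

definition last_argmax :: "nat \<Rightarrow> (nat \<Rightarrow> ereal) \<Rightarrow> nat \<Rightarrow> nat" where
  "last_argmax m f k = Max {j. is_arg_max f (\<lambda>j. j \<in> {k - m..k}) j}"

end

theory Submission
  imports Defs
begin

text \<open>
  Write \<open>M k = \<Phi> (x (l k))\<close>, \<open>d k = \<parallel>x (k+1) - x k\<parallel>\<close>, \<open>g k = sqrt (M k - \<Phi> (x k))\<close>, \<open>e k = d (l k - 1)\<close> and let
  \<open>L\<close> be the limit of \<open>M\<close>, which is also the value of \<open>\<Phi>\<close> on the compact set of cluster points.
  If \<open>M\<close> attains \<open>L\<close>, the descent condition forces \<open>\<Phi> (x k) = L\<close> for all large \<open>k\<close>. Otherwise the KL
  inequality at \<open>x (l k)\<close> together with
  \<open>a (e (k+m+1))\<^sup>2 \<le> M k - M (k+m+1)\<close> shows that \<open>e k\<close> and \<open>s k = sqrt (M k - M (k+1))\<close> are summable.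
  The weak convexity inequality at \<open>z = x (l k)\<close>, \<open>y = x k\<close> bounds \<open>(g k)\<^sup>2\<close> by
  \<open>b e k R + a\<^sub>0 R\<^sup>2\<close>, where \<open>R\<close> is at most the sum of \<open>d j\<close> over the \<open>m\<close> indices before \<open>k\<close>, and
  descent gives \<open>sqrt a * d j \<le> s j + g (j+1)\<close>. The bound on \<open>a\<^sub>0\<close> makes this a contraction for the
  partial sums of \<open>g\<close>, so \<open>g\<close> is summable over all indices.
\<close>

section \<open>Summability criteria for nonnegative real sequences\<close>

lemma sum_window_le:
  fixes h :: "nat \<Rightarrow> real"
  assumes "\<And>j. 0 \<le> h j"
  shows "(\<Sum>k\<le>N. \<Sum>j=k-m..<k. h j) \<le> real m * (\<Sum>j<N. h j)"
proof -
  have "(\<Sum>k\<le>N. \<Sum>j=k-m..<k. h j) = (\<Sum>k\<le>N. \<Sum>j\<in>{j\<in>{..<N}. k - m \<le> j \<and> j < k}. h j)"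
    by (intro sum.cong) auto
  also have "\<dots> = (\<Sum>j<N. \<Sum>k\<in>{k\<in>{..N}. k - m \<le> j \<and> j < k}. h j)"
    by (rule sum.swap_restrict) auto
  also have "\<dots> \<le> (\<Sum>j<N. real m * h j)"
  proof (rule sum_mono)
    fix j
    \<comment> \<open>After the exchange of sums, \<open>h j\<close> is counted once for each window
      containing \<open>j\<close>, and these windows end at one of the \<open>m\<close> indices
      following \<open>j\<close>.\<close>
    have "card {k\<in>{..N}. k - m \<le> j \<and> j < k} \<le> card {j<..j+m}"
      by (rule card_mono) auto
    then show "(\<Sum>k\<in>{k\<in>{..N}. k - m \<le> j \<and> j < k}. h j) \<le> real m * h j"
      using assms by (auto intro!: mult_right_mono)
  qed
  finally show ?thesis by (simp add: sum_distrib_left)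
qed

text \<open>Shifting by \<open>p\<close> only adds the first \<open>p\<close> terms to a partial sum
  \<open>S\<close>, so summing \<open>step\<close> gives \<open>S\<close> \<le> \<open>S / 2\<close>
  plus a constant, which bounds \<open>S\<close>.\<close>

lemma summable_contraction:
  fixes e c :: "nat \<Rightarrow> real"
  assumes e: "\<And>k. 0 \<le> e k" and c: "summable c" "\<And>k. 0 \<le> c k"
    and step: "\<And>k. e (k + p) \<le> e k / 2 + c k"
  shows "summable e"
proof (rule summableI_nonneg_bounded[OF e])
  fix n
  have "(\<Sum>k<n. e k) \<le> (\<Sum>k<p + n. e k)"
    using e by (intro sum_mono2) auto
  also have "\<dots> = (\<Sum>k<p. e k) + (\<Sum>k<n. e (k + p))"
    by (induction n) (simp_all add: add.commute)
  also have "(\<Sum>k<n. e (k + p)) \<le> (\<Sum>k<n. e k / 2 + c k)"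
    using step by (rule sum_mono)
  also have "(\<Sum>k<n. e k / 2 + c k) \<le> (\<Sum>k<n. e k) / 2 + suminf c"
    using sum_le_suminf[OF c(1), of "{..<n}"] c(2) by (simp add: sum.distrib sum_divide_distrib)
  finally show "(\<Sum>k<n. e k) \<le> 2 * ((\<Sum>k<p. e k) + suminf c)" by simp
qed

lemma summable_diff_shift:
  fixes u :: "nat \<Rightarrow> real"
  assumes "convergent u"
  shows "summable (\<lambda>k. u k - u (k + p))"
proof (induction p)
  case (Suc p)
  obtain L where L: "(\<lambda>k. u (k + p)) \<longlonglongrightarrow> L"
    using assms by (metis LIMSEQ_ignore_initial_segment convergent_def)
  have "summable (\<lambda>k. u (k + p) - u (Suc k + p))"
    by (rule telescope_summable'[OF L])
  from summable_add[OF Suc this] show ?case by simp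
qed simp

text \<open>Summed up to \<open>n\<close>, the window terms return each \<open>g j\<close> at most
  \<open>m\<close> times. The partial sum \<open>S\<close> is thus at most a constant plus
  \<open>q * m * S\<close>, and \<open>q * m < 1\<close> allows solving for \<open>S\<close>. The
  finitely many indices where the estimate may fail enter the constant.\<close>

lemma summable_window:
  fixes g s c :: "nat \<Rightarrow> real"
  assumes g: "\<And>k. 0 \<le> g k" and s: "summable s" "\<And>k. 0 \<le> s k"
    and c: "summable c" "\<And>k. 0 \<le> c k" and q: "0 \<le> q" "q * real m < 1"
    and ev: "\<forall>\<^sub>F k in sequentially. g k \<le> c k + q * (\<Sum>j=k-m..<k. s j + g (Suc j))"
  shows "summable g"
proof -
  obtain K where K: "\<And>k. k \<ge> K \<Longrightarrow> g k \<le> c k + q * (\<Sum>j=k-m..<k. s j + g (Suc j))"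
    using ev by (auto simp: eventually_sequentially)
  define B where "B = (\<Sum>k<K. g k) + suminf c + q * real m * suminf s"
  show ?thesis
  proof (rule bounded_imp_summable[OF g])
    fix n
    define S where "S = (\<Sum>k\<le>n. g k)"
    define W where "W k = (\<Sum>j=k-m..<k. s j + g (Suc j))" for k
    have "g k \<le> (if k < K then g k else 0) + c k + q * W k" for k
      using K[of k] c(2)[of k] q(1) s(2) g unfolding W_def
      by (auto intro!: add_nonneg_nonneg mult_nonneg_nonneg sum_nonneg)
    then have "S \<le> (\<Sum>k\<le>n. (if k < K then g k else 0) + c k + q * W k)"
      unfolding S_def by (rule sum_mono)
    also have "\<dots> = (\<Sum>k\<le>n. (if k < K then g k else 0)) + (\<Sum>k\<le>n. c k) + q * (\<Sum>k\<le>n. W k)"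
      by (simp only: sum.distrib sum_distrib_left)
    finally have "S \<le> (\<Sum>k\<le>n. (if k < K then g k else 0)) + (\<Sum>k\<le>n. c k) + q * (\<Sum>k\<le>n. W k)" .
    moreover have "(\<Sum>k\<le>n. (if k < K then g k else 0)) \<le> (\<Sum>k<K. g k)"
    proof -
      have "(\<Sum>k\<le>n. (if k < K then g k else 0)) = (\<Sum>k\<in>{k\<in>{..n}. k < K}. g k)"
        by (rule sum.inter_filter[symmetric]) simp
      also have "\<dots> \<le> (\<Sum>k<K. g k)"
        using g by (intro sum_mono2) auto
      finally show ?thesis .
    qed
    moreover have "(\<Sum>k\<le>n. c k) \<le> suminf c"
      using c by (intro sum_le_suminf) auto
    moreover have "q * (\<Sum>k\<le>n. W k) \<le> q * (real m * (suminf s + S))"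
    proof (intro mult_left_mono q(1))
      have "(\<Sum>k\<le>n. W k) \<le> real m * (\<Sum>j<n. s j + g (Suc j))"
        unfolding W_def using s g by (intro sum_window_le) simp
      also have "(\<Sum>j<n. s j + g (Suc j)) \<le> suminf s + S"
      proof -
        have "S = g 0 + (\<Sum>j<n. g (Suc j))"
          unfolding S_def by (simp add: sum.atMost_shift)
        then show ?thesis
          using sum_le_suminf[OF s(1), of "{..<n}"] s(2) g[of 0] by (simp add: sum.distrib)
      qed
      finally show "(\<Sum>k\<le>n. W k) \<le> real m * (suminf s + S)" by (simp add: mult_left_mono)
    qed
    ultimately have "(1 - q * real m) * S \<le> B"
      unfolding B_def by (simp add: algebra_simps)
    then show "(\<Sum>k\<le>n. g k) \<le> B / (1 - q * real m)"
      using q(2) by (simp add: S_def[symmetric] pos_le_divide_eq mult.commute)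
  qed
qed

text \<open>Multiplying the KL inequality by \<open>M k - M (k + p)\<close> and using the tangent
  inequality gives \<open>M k - M (k + p) \<le> b * e k * c k\<close>, where \<open>c\<close> is a
  \<open>p\<close>-step difference of the convergent sequence \<open>\<psi> (M k - L)\<close> and
  hence summable. With \<open>step\<close> and the arithmetic-geometric mean inequality,
  \<open>e\<close> satisfies a contraction with shift \<open>p\<close>; the same estimate then
  controls the square roots.\<close>

lemma KL_rate_summable:
  fixes M e \<psi> D :: "_ \<Rightarrow> real"
  assumes M: "decseq M" "M \<longlonglongrightarrow> L" "\<And>k. L < M k"
    and e: "\<And>k. 0 \<le> e k" and ab: "0 < a" "0 < b"
    and step: "\<And>k. a * (e (k + p))\<^sup>2 \<le> M k - M (k + p)" and p: "0 < p"
    and \<eta>: "0 < \<eta>"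
    and \<psi>: "\<And>t. 0 < t \<Longrightarrow> t < \<eta> \<Longrightarrow> 0 \<le> \<psi> t"
    and tangent: "\<And>s t. 0 < t \<Longrightarrow> t \<le> s \<Longrightarrow> s < \<eta> \<Longrightarrow> D s * (s - t) \<le> \<psi> s - \<psi> t"
    and KL: "\<forall>\<^sub>F k in sequentially. 1 \<le> D (M k - L) * (b * e k)"
  shows "summable e" "summable (\<lambda>k. sqrt (M k - M (Suc k)))"
proof -
  have "\<forall>\<^sub>F k in sequentially. M k < L + \<eta>"
    using order_tendstoD(2)[OF M(2)] \<eta> by simp
  with KL have "\<forall>\<^sub>F k in sequentially. 1 \<le> D (M k - L) * (b * e k) \<and> M k < L + \<eta>"
    by eventually_elim simp
  then obtain K where K: "\<And>k. 1 \<le> D (M (k + K) - L) * (b * e (k + K)) \<and> M (k + K) < L + \<eta>"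
    unfolding eventually_sequentially by (metis le_add2)
  define u where "u k = \<psi> (M (k + K) - L)" for k
  define c where "c k = u k - u (k + p)" for k
  have Mle: "M j \<le> M i" if "i \<le> j" for i j
    using M(1) that by (simp add: decseq_def)
  \<comment> \<open>A product with the nonnegative factor \<open>b * e\<close> can reach 1 only if
    \<open>D\<close> is positive there; this makes \<open>u\<close> decreasing.\<close>
  have D0: "0 < D (M (k + K) - L)" for k
  proof (rule ccontr)
    assume "\<not> ?thesis"
    then have "D (M (k + K) - L) * (b * e (k + K)) \<le> 0"
      using e[of "k + K"] ab by (intro mult_nonpos_nonneg) auto
    with K[of k] show False by simp
  qed
  have u_diff: "D (M (i + K) - L) * (M (i + K) - M (j + K)) \<le> u i - u j" if "i \<le> j" for i j
    using tangent[of "M (j + K) - L" "M (i + K) - L"] M(3) K[of i] Mle[of "i+K" "j+K"] that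
    by (simp add: u_def)
  have "decseq u"
    unfolding decseq_def
  proof (intro allI impI)
    fix i j :: nat assume "i \<le> j"
    moreover from this have "0 \<le> D (M (i + K) - L) * (M (i + K) - M (j + K))"
      using D0[of i] Mle[of "i+K" "j+K"] by simp
    ultimately show "u j \<le> u i" using u_diff[of i j] by linarith
  qed
  moreover have "0 \<le> u k" for k
    unfolding u_def using M(3) K[of k] by (intro \<psi>) auto
  ultimately have "convergent u"
    by (metis decseq_convergent convergentI)
  then have sc: "summable c"
    unfolding c_def by (rule summable_diff_shift)
  have c0: "0 \<le> c k" for k
    using \<open>decseq u\<close> by (simp add: c_def decseq_def)
  have key: "M (k + K) - M (k + p + K) \<le> b * e (k + K) * c k" for k
  proof -
    have "M (k + K) - M (k + p + K) \<le> (D (M (k + K) - L) * (b * e (k + K))) * (M (k + K) - M (k + p + K))"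
      using mult_right_mono[of 1 "D (M (k + K) - L) * (b * e (k + K))" "M (k + K) - M (k + p + K)"]
        K[of k] Mle[of "k+K" "k+p+K"] by simp
    also have "\<dots> = (b * e (k + K)) * (D (M (k + K) - L) * (M (k + K) - M (k + p + K)))"
      by (simp add: algebra_simps)
    also have "\<dots> \<le> (b * e (k + K)) * c k"
      unfolding c_def using u_diff[of k "k + p"] e ab by (intro mult_left_mono) auto
    finally show ?thesis .
  qed
  have "summable (\<lambda>k. e (k + K))"
  proof (rule summable_contraction)
    show "summable (\<lambda>k. b / a * c k)" using sc by (rule summable_mult)
    show "0 \<le> b / a * c k" for k using ab c0 by simp
    show "e (k + p + K) \<le> e (k + K) / 2 + b / a * c k" for k
    proof (rule power2_le_imp_le)
      have "a * (e (k + p + K))\<^sup>2 \<le> b * e (k + K) * c k"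
        using step[of "k + K"] key[of k] by (simp add: ac_simps)
      then have "(e (k + p + K))\<^sup>2 \<le> e (k + K) * (b / a * c k)"
        using ab by (simp add: field_simps)
      also have "\<dots> \<le> (e (k + K) / 2 + b / a * c k)\<^sup>2"
        using zero_le_power2[of "e (k + K) / 2"] zero_le_power2[of "b / a * c k"]
        unfolding power2_sum by (simp add: ac_simps)
      finally show "(e (k + p + K))\<^sup>2 \<le> (e (k + K) / 2 + b / a * c k)\<^sup>2" .
      show "0 \<le> e (k + K) / 2 + b / a * c k" using e ab c0 by simp
    qed
  qed (rule e)
  then have se: "summable (\<lambda>k. e (k + K))" .
  then show "summable e" by (simp add: summable_iff_shift)
  have "summable (\<lambda>k. sqrt (M (k + K) - M (Suc (k + K))))"
  proof (rule summable_comparison_test')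
    show "summable (\<lambda>k. b * e (k + K) + c k)"
      using se sc by (intro summable_add summable_mult)
    fix k :: nat
    have "M (k + K) - M (Suc (k + K)) \<le> b * e (k + K) * c k"
      using key[of k] Mle[of "Suc (k + K)" "k + p + K"] p by simp
    also have "\<dots> \<le> (b * e (k + K) + c k)\<^sup>2"
      using ab e[of "k+K"] c0[of k] by (simp add: power2_sum)
    finally have "sqrt (M (k + K) - M (Suc (k + K))) \<le> b * e (k + K) + c k"
      using ab e[of "k+K"] c0[of k] by (intro real_le_lsqrt) auto
    then show "norm (sqrt (M (k + K) - M (Suc (k + K)))) \<le> b * e (k + K) + c k"
      using Mle[of "k + K" "Suc (k + K)"] by simp
  qed
  then show "summable (\<lambda>k. sqrt (M k - M (Suc k)))"
    by (simp add: summable_iff_shift[of "\<lambda>k. sqrt (M k - M (Suc k))"])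
qed

section \<open>Closedness of the limiting subdifferential and limits under lower
  semicontinuity\<close>

lemma limiting_subdiff_iff_closure:
  "v \<in> limiting_subdiff h x \<longleftrightarrow>
     \<bar>h x\<bar> \<noteq> \<infinity> \<and> (x, h x, v) \<in> closure {(y, h y, z) |y z. z \<in> regular_subdiff h y}"
  (is "_ \<longleftrightarrow> _ \<and> _ \<in> closure ?G")
proof -
  have "(x, h x, v) \<in> closure ?G \<longleftrightarrow>
      (\<exists>u w. (\<forall>k. w k \<in> regular_subdiff h (u k)) \<and>
        u \<longlonglongrightarrow> x \<and> (\<lambda>k. h (u k)) \<longlonglongrightarrow> h x \<and> w \<longlonglongrightarrow> v)" (is "_ \<longleftrightarrow> ?R")
  proof
    assume "(x, h x, v) \<in> closure ?G"
    then obtain g where g: "\<And>n. g n \<in> ?G" "g \<longlonglongrightarrow> (x, h x, v)"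
      unfolding closure_sequential by blast
    have "snd (snd (g n)) \<in> regular_subdiff h (fst (g n)) \<and> h (fst (g n)) = fst (snd (g n))" for n
      using g(1)[of n] by auto
    then show ?R
      using tendsto_fst[OF g(2)] tendsto_fst[OF tendsto_snd[OF g(2)]] tendsto_snd[OF tendsto_snd[OF g(2)]]
      by (intro exI[of _ "\<lambda>n. fst (g n)"] exI[of _ "\<lambda>n. snd (snd (g n))"]) simp
  next
    assume ?R
    then obtain u w where uw: "\<forall>k. w k \<in> regular_subdiff h (u k)"
      "u \<longlonglongrightarrow> x" "(\<lambda>k. h (u k)) \<longlonglongrightarrow> h x" "w \<longlonglongrightarrow> v" by blast
    show "(x, h x, v) \<in> closure ?G"
      unfolding closure_sequential
    proof (intro exI conjI allI)
      show "(\<lambda>k. (u k, h (u k), w k)) \<longlonglongrightarrow> (x, h x, v)"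
        using uw by (intro tendsto_Pair)
    qed (use uw in auto)
  qed
  then show ?thesis by (simp add: limiting_subdiff_def)
qed

text \<open>With the value of \<open>h\<close> as an extra coordinate, limiting subgradients are
  closure points of the graph of regular ones. Idempotence of closure then takes the place of a
  diagonal sequence.\<close>

lemma limiting_subdiff_closed:
  assumes w: "\<And>k. w k \<in> limiting_subdiff h (u k)" and fin: "\<bar>h p\<bar> \<noteq> \<infinity>"
    and lim: "u \<longlonglongrightarrow> p" "(\<lambda>k. h (u k)) \<longlonglongrightarrow> h p" "w \<longlonglongrightarrow> v"
  shows "v \<in> limiting_subdiff h p"
proof -
  let ?G = "{(y, h y, z) |y z. z \<in> regular_subdiff h y}"
  have "(\<lambda>k. (u k, h (u k), w k)) \<longlonglongrightarrow> (p, h p, v)"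
    using lim by (intro tendsto_Pair)
  moreover have "(u k, h (u k), w k) \<in> closure ?G" for k
    using w[of k] by (simp add: limiting_subdiff_iff_closure)
  ultimately have "(p, h p, v) \<in> closure (closure ?G)"
    unfolding closure_sequential[of _ "closure ?G"] by (intro exI conjI allI)
  then show ?thesis using fin by (simp add: limiting_subdiff_iff_closure)
qed

lemma lsc_fun_limit_le:
  fixes h :: "'a::topological_space \<Rightarrow> ereal"
  assumes "lsc_fun h" "u \<longlonglongrightarrow> p" "(\<lambda>k. h (u k)) \<longlonglongrightarrow> c"
  shows "h p \<le> c"
proof (rule ccontr)
  assume "\<not> ?thesis"
  then obtain d where d: "c < d" "d < h p" using dense by (meson not_le)
  have "d < Liminf (at p) h"
    using d(2) assms(1) unfolding lsc_fun_def by (meson less_le_trans)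
  then have "\<forall>\<^sub>F y in at p. d < h y" by (rule less_LiminfD)
  \<comment> \<open>The lower limit ignores the point \<open>p\<close> itself, which the sequence
    may visit; \<open>d < h p\<close> covers it.\<close>
  then have "\<forall>\<^sub>F y in nhds p. d < h y"
    unfolding eventually_at_filter by eventually_elim (use d in auto)
  then have "\<forall>\<^sub>F k in sequentially. d < h (u k)"
    using assms(2) by (auto simp: filterlim_iff)
  then have "d \<le> c"
    using tendsto_lowerbound[OF assms(3)] by (meson eventually_mono less_imp_le trivial_limit_sequentially)
  with d show False by simp
qed

section \<open>The KL inequality, made uniform on compact sets\<close>

lemma edist_le_norm: "w \<in> S \<Longrightarrow> edist 0 S \<le> ereal (norm w)"
  unfolding edist_def by (rule INF_lower2[of w]) (simp_all add: dist_norm)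

lemma KL_desingularizer_tangent:
  assumes \<phi>: "\<phi> \<in> KL_desingularizers \<eta>" and st: "0 < s" "ereal s < \<eta>" "0 < t" "ereal t < \<eta>"
  shows "deriv \<phi> s * (s - t) \<le> \<phi> s - \<phi> t"
proof -
  let ?I = "{t. 0 < t \<and> ereal t < \<eta>}"
  have op: "open ?I"
    by (intro open_Collect_conj open_Collect_less continuous_intros continuous_on_ereal)
  have cvx: "convex ?I" 
    by (intro is_interval_convex) (auto simp: is_interval_def; metis ereal_less_eq(3) le_less_trans less_le_trans)
  have "convex_on {t. 0 \<le> t \<and> ereal t < \<eta>} (\<lambda>t. - \<phi> t)"
    using \<phi> by (simp add: KL_desingularizers_def concave_on_def)
  then have convex: "convex_on ?I (\<lambda>t. - \<phi> t)"
    by (rule convex_on_subset) (use cvx in auto)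
  have "\<phi> differentiable at s"
    using \<phi> st unfolding KL_desingularizers_def C1_differentiable_on_eq by blast
  then have "(\<phi> has_field_derivative deriv \<phi> s) (at s)"
    using DERIV_deriv_iff_real_differentiable by blast
  then have "((\<lambda>t. - \<phi> t) has_field_derivative - deriv \<phi> s) (at s within ?I)"
    by (rule has_field_derivative_at_within[OF DERIV_minus])
  with convex have "- \<phi> t - - \<phi> s \<ge> - deriv \<phi> s * (t - s)"
    using st op cvx by (intro convex_on_imp_above_tangent[of ?I]) (auto simp: interior_open convex_connected)
  then show ?thesis by (simp add: algebra_simps)
qed

text \<open>A uniform form of the KL inequality around the level set of \<open>L\<close>. Only the tangent inequality
  of a concave \<open>\<psi>\<close> with derivative \<open>D\<close> is kept, because this is stable under sums.\<close>

definition KL_bound :: "('a::euclidean_space \<Rightarrow> ereal) \<Rightarrow> real \<Rightarrow> 'a set \<Rightarrow> real \<Rightarrow>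
    (real \<Rightarrow> real) \<Rightarrow> (real \<Rightarrow> real) \<Rightarrow> bool" where
  "KL_bound h L U \<eta> \<psi> D \<longleftrightarrow> 0 < \<eta> \<and> open U \<and>
     (\<forall>t. 0 < t \<and> t < \<eta> \<longrightarrow> 0 \<le> \<psi> t \<and> 0 \<le> D t) \<and>
     (\<forall>s t. 0 < s \<and> s < \<eta> \<and> 0 < t \<and> t < \<eta> \<longrightarrow> D s * (s - t) \<le> \<psi> s - \<psi> t) \<and>
     (\<forall>y\<in>U. \<forall>w\<in>limiting_subdiff h y. \<forall>t. 0 < t \<and> t < \<eta> \<and> h y = ereal (L + t) \<longrightarrow>
        1 \<le> D t * norm w)"

lemma KL_property_imp_KL_bound:
  assumes "KL_property_at h p" "h p = ereal L"
  obtains U \<eta> \<psi> D where "p \<in> U" "KL_bound h L U \<eta> \<psi> D"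
proof -
  obtain \<eta> U \<phi> where *: "0 < \<eta>" "open U" "p \<in> U" "\<phi> \<in> KL_desingularizers \<eta>"
    and KL: "\<And>y. y \<in> U \<Longrightarrow> h p < h y \<Longrightarrow> h y < h p + \<eta> \<Longrightarrow>
       1 \<le> ereal (deriv \<phi> (real_of_ereal (h y - h p))) * edist 0 (limiting_subdiff h y)"
    using assms(1) unfolding KL_property_at_def by blast
  \<comment> \<open>Since \<eta> may be infinite, it is shrunk to a real threshold; the KL
    inequality survives on the smaller range.\<close>
  obtain \<theta> where \<theta>: "0 < \<theta>" "ereal \<theta> < \<eta>"
    using *(1) by (metis ereal_dense2 ereal_less(2) zero_ereal_def)
  have lt: "ereal t < \<eta>" if "t < \<theta>" for t
    using that \<theta> by (meson ereal_less_eq(3) le_less_trans less_imp_le)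
  have "1 \<le> deriv \<phi> t * norm w"
    if "y \<in> U" "w \<in> limiting_subdiff h y" "0 < t" "t < \<theta>" "h y = ereal (L + t)" for y w t
  proof -
    have pos: "0 < deriv \<phi> t"
      using *(4) that lt by (auto simp: KL_desingularizers_def)
    have "h y < h p + \<eta>"
      using lt[OF that(4)] assms(2) that(5) by (cases \<eta>) auto
    then have "1 \<le> ereal (deriv \<phi> t) * edist 0 (limiting_subdiff h y)"
      using KL[of y] that assms(2) by simp
    also have "\<dots> \<le> ereal (deriv \<phi> t) * ereal (norm w)"
      using pos by (intro ereal_mult_left_mono edist_le_norm that) simp
    finally show ?thesis by simp
  qed
  moreover have "0 \<le> \<phi> t \<and> 0 \<le> deriv \<phi> t" if "0 < t" "t < \<theta>" for t
    using *(4) that lt by (auto simp: KL_desingularizers_def intro: less_imp_le)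
  ultimately have "KL_bound h L U \<theta> \<phi> (deriv \<phi>)"
    using * \<theta> lt KL_desingularizer_tangent[OF *(4)] by (simp add: KL_bound_def)
  with *(3) show ?thesis by (rule that)
qed

lemma KL_bound_empty: "KL_bound h L {} 1 (\<lambda>_. 0) (\<lambda>_. 0)"
  by (simp add: KL_bound_def)

text \<open>A point of the union satisfies one of the two inequalities, and adding the other
  nonnegative product keeps it at least 1. Tangent inequalities add up directly.\<close>

lemma KL_bound_Un:
  assumes "KL_bound h L U \<eta> \<psi> D" "KL_bound h L U' \<eta>' \<psi>' D'"
  shows "KL_bound h L (U \<union> U') (min \<eta> \<eta>') (\<lambda>t. \<psi> t + \<psi>' t) (\<lambda>t. D t + D' t)"
proof -
  have "1 \<le> (D t + D' t) * norm w"
    if "y \<in> U \<union> U'" "w \<in> limiting_subdiff h y" "0 < t" "t < \<eta>" "t < \<eta>'" "h y = ereal (L + t)" for y w t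
  proof -
    have "0 \<le> D t * norm w" "0 \<le> D' t * norm w"
      using assms that by (auto simp: KL_bound_def)
    moreover have "1 \<le> D t * norm w \<or> 1 \<le> D' t * norm w"
      using assms that unfolding KL_bound_def by blast
    ultimately show ?thesis by (auto simp: distrib_right)
  qed
  moreover have "(D s + D' s) * (s - t) \<le> (\<psi> s + \<psi>' s) - (\<psi> t + \<psi>' t)"
    if "0 < s" "s < \<eta>" "s < \<eta>'" "0 < t" "t < \<eta>" "t < \<eta>'" for s t
  proof -
    have "D s * (s - t) \<le> \<psi> s - \<psi> t" "D' s * (s - t) \<le> \<psi>' s - \<psi>' t"
      using assms that unfolding KL_bound_def by blast+
    then show ?thesis by (simp add: distrib_right)
  qed
  ultimately show ?thesis
    using assms by (simp add: KL_bound_def open_Un)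
qed

text \<open>The open sets carrying some KL bound at level \<open>L\<close> cover \<open>C\<close>
  and are stable under finite unions, so the union of a finite subcover carries a single
  one.\<close>

lemma compact_KL_bound:
  assumes "compact C" and KL: "\<And>p. p \<in> C \<Longrightarrow> KL_property_at h p" "\<And>p. p \<in> C \<Longrightarrow> h p = ereal L"
  obtains U \<eta> \<psi> D where "C \<subseteq> U" "KL_bound h L U \<eta> \<psi> D"
proof -
  define \<U> where "\<U> = {U. \<exists>\<eta> \<psi> D. KL_bound h L U \<eta> \<psi> D}"
  have "C \<subseteq> \<Union>\<U>"
  proof
    fix p assume "p \<in> C"
    with KL obtain U \<eta> \<psi> D where "p \<in> U" "KL_bound h L U \<eta> \<psi> D"
      using KL_property_imp_KL_bound by metis
    then show "p \<in> \<Union>\<U>" by (auto simp: \<U>_def)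
  qed
  moreover have "open U" if "U \<in> \<U>" for U
    using that by (auto simp: \<U>_def KL_bound_def)
  ultimately obtain \<V> where \<V>: "\<V> \<subseteq> \<U>" "finite \<V>" "C \<subseteq> \<Union>\<V>"
    using compactE[OF assms(1)] by metis
  have "\<Union>\<V> \<in> \<U>"
    using \<V>(2,1)
  proof (induction rule: finite_induct)
    case empty
    have "{} \<in> \<U>" unfolding \<U>_def using KL_bound_empty by blast
    then show ?case by simp
  next
    case (insert U \<V>)
    then show ?case using KL_bound_Un by (fastforce simp: \<U>_def)
  qed
  with \<V>(3) show ?thesis using that by (auto simp: \<U>_def)
qed

section \<open>Cluster points of bounded sequences\<close>

lemma cluster_point_iff:
  fixes x :: "nat \<Rightarrow> 'a::metric_space"
  shows "z \<in> cluster_points x \<longleftrightarrow> (\<forall>e>0. \<forall>n. \<exists>k\<ge>n. dist (x k) z < e)"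
proof
  assume "z \<in> cluster_points x"
  then obtain r where r: "strict_mono r" "(x \<circ> r) \<longlonglongrightarrow> z"
    by (auto simp: cluster_points_def)
  show "\<forall>e>0. \<forall>n. \<exists>k\<ge>n. dist (x k) z < e"
  proof (intro allI impI)
    fix e :: real and n :: nat assume "e > 0"
    then obtain N where "\<And>k. k \<ge> N \<Longrightarrow> dist ((x \<circ> r) k) z < e"
      using r(2) unfolding lim_sequentially by blast
    then have "dist (x (r (max n N))) z < e" by simp
    moreover have "r (max n N) \<ge> n"
      using seq_suble[OF r(1), of "max n N"] by simp
    ultimately show "\<exists>k\<ge>n. dist (x k) z < e" by blast
  qed
next
  assume *: "\<forall>e>0. \<forall>n. \<exists>k\<ge>n. dist (x k) z < e"
  \<comment> \<open>The subsequence is built recursively, with tolerances \<open>1 / (n + 1)\<close>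
    and strictly growing indices.\<close>
  have "\<exists>r. \<forall>n. dist (x (r n)) z < 1 / real (Suc n) \<and> r n < r (Suc n)"
  proof (rule dependent_nat_choice)
    show "\<exists>k. dist (x k) z < 1 / real (Suc 0)" using * by (metis zero_less_one div_by_1 of_nat_1 One_nat_def)
    fix k n
    show "\<exists>j. dist (x j) z < 1 / real (Suc (Suc n)) \<and> k < j"
      using *[rule_format, of "1 / real (Suc (Suc n))" "Suc k"] by (auto simp: Suc_le_eq)
  qed
  then obtain r where r: "\<And>n. dist (x (r n)) z < 1 / real (Suc n)" "\<And>n. r n < r (Suc n)" by blast
  have "(\<lambda>n. dist (x (r n)) z) \<longlonglongrightarrow> 0"
  proof (rule tendsto_sandwich[OF _ _ tendsto_const[of 0]])
    show "(\<lambda>n. 1 / real (Suc n)) \<longlonglongrightarrow> 0" by (rule lim_1_over_n[THEN LIMSEQ_Suc])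
    show "\<forall>\<^sub>F n in sequentially. dist (x (r n)) z \<le> 1 / real (Suc n)"
      using r(1) by (intro always_eventually allI less_imp_le)
  qed simp
  then have "(x \<circ> r) \<longlonglongrightarrow> z" unfolding o_def by (rule tendsto_dist_iff[THEN iffD2])
  moreover have "strict_mono r" using r(2) by (simp add: strict_mono_Suc_iff)
  ultimately show "z \<in> cluster_points x" by (auto simp: cluster_points_def)
qed

text \<open>An intersection of closures of tails is visibly closed, which yields compactness once
  the sequence is bounded.\<close>

lemma cluster_points_eq_Inter:
  fixes x :: "nat \<Rightarrow> 'a::metric_space"
  shows "cluster_points x = (\<Inter>n. closure (x ` {n..}))"
  unfolding set_eq_iff cluster_point_iff closure_approachable INT_iff by (auto simp: Bex_def)

lemma compact_cluster_points:
  fixes x :: "nat \<Rightarrow> 'a::heine_borel"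
  assumes "bounded (range x)"
  shows "compact (cluster_points x)"
proof -
  have "cluster_points x \<subseteq> closure (range x)"
  proof -
    have "cluster_points x \<subseteq> closure (x ` {0..})"
      unfolding cluster_points_eq_Inter by (rule INT_lower) simp
    then show ?thesis by simp
  qed
  moreover have "closed (cluster_points x)"
    unfolding cluster_points_eq_Inter by (intro closed_INT ballI closed_closure)
  ultimately show ?thesis
    using bounded_subset[OF bounded_closure[OF assms]] by (simp add: compact_eq_bounded_closed)
qed

text \<open>Otherwise the terms outside \<open>U\<close> form a bounded subsequence in a closed set,
  and a convergent part of it has its limit, a cluster point, outside \<open>U\<close>.\<close>

lemma eventually_in_nhd_cluster_points:
  fixes x :: "nat \<Rightarrow> 'a::heine_borel"
  assumes "bounded (range x)" "open U" "cluster_points x \<subseteq> U"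
  shows "\<forall>\<^sub>F k in sequentially. x k \<in> U"
proof (rule ccontr)
  assume "\<not> ?thesis"
  then have inf: "infinite {k. x k \<notin> U}"
    by (simp add: not_eventually frequently_cofinite flip: cofinite_eq_sequentially)
  define r where "r = enumerate {k. x k \<notin> U}"
  have r: "strict_mono r" "\<And>k. x (r k) \<notin> U"
    unfolding r_def using strict_mono_enumerate[OF inf] enumerate_in_set[OF inf] by auto
  have "bounded (range (x \<circ> r))"
    using assms(1) by (rule bounded_subset) auto
  then obtain l s where s: "strict_mono s" "((x \<circ> r) \<circ> s) \<longlonglongrightarrow> l"
    using bounded_imp_convergent_subsequence by blast
  have "strict_mono (r \<circ> s)" "(x \<circ> (r \<circ> s)) \<longlonglongrightarrow> l"
    using strict_mono_o[OF r(1) s(1)] s(2) by (simp_all only: o_assoc)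
  then have "l \<in> cluster_points x"
    unfolding cluster_points_def by blast
  moreover have "l \<in> - U"
  proof (rule closed_sequentially)
    show "closed (- U)" using assms(2) by (rule closed_Compl)
    show "((x \<circ> r) \<circ> s) n \<in> - U" for n using r(2) by simp
  qed (rule s(2))
  ultimately show False using assms(3) by auto
qed

text \<open>Meant for \<open>j = l\<close>: replacing each \<open>x k\<close> by a point at
  vanishing distance keeps subsequential limits, although \<open>j \<circ> r\<close> itself need not
  be increasing.\<close>

lemma cluster_point_perturbed:
  fixes x :: "nat \<Rightarrow> 'a::metric_space"
  assumes d: "(\<lambda>k. dist (x (j k)) (x k)) \<longlonglongrightarrow> 0"
    and p: "p \<in> cluster_points x"
  obtains r where "strict_mono r" "(\<lambda>n. x (j (r n))) \<longlonglongrightarrow> p"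
proof -
  obtain r where r: "strict_mono r" "(x \<circ> r) \<longlonglongrightarrow> p"
    using p by (auto simp: cluster_points_def)
  have "(\<lambda>n. dist (x (j (r n))) (x (r n)) + dist (x (r n)) p) \<longlonglongrightarrow> 0 + 0"
    using LIMSEQ_subseq_LIMSEQ[OF d r(1)] r(2)[THEN tendsto_dist_iff[THEN iffD1]]
    unfolding o_def by (rule tendsto_add)
  then have "(\<lambda>n. dist (x (j (r n))) (x (r n)) + dist (x (r n)) p) \<longlonglongrightarrow> 0" by simp
  from tendsto_sandwich[OF _ _ tendsto_const[of 0] this]
  have "(\<lambda>n. dist (x (j (r n))) p) \<longlonglongrightarrow> 0"
    by (simp add: dist_triangle)
  then have "(\<lambda>n. x (j (r n))) \<longlonglongrightarrow> p" by (rule tendsto_dist_iff[THEN iffD2])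
  with r(1) show ?thesis by (rule that)
qed

text \<open>The window is finite and nonempty, so the set of maximizing indices is too, and its
  \<open>Max\<close> is a genuine member.\<close>

lemma last_argmax_window:
  "last_argmax m f k \<in> {k - m..k}" "\<And>j. j \<in> {k - m..k} \<Longrightarrow> f j \<le> f (last_argmax m f k)"
proof -
  let ?A = "{j. is_arg_max f (\<lambda>j. j \<in> {k - m..k}) j}"
  have "?A \<subseteq> {k - m..k}" by (auto simp: is_arg_max_def)
  then have "finite ?A" by (rule finite_subset) simp
  moreover have "?A \<noteq> {}"
  proof -
    have "Max (f ` {k - m..k}) \<in> f ` {k - m..k}" by (rule Max_in) auto
    then obtain j where "j \<in> {k - m..k}" "Max (f ` {k - m..k}) = f j" by blast
    then have "j \<in> ?A"
      unfolding is_arg_max_def using Max_ge[of "f ` {k - m..k}"] by (force simp: not_less)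
    then show ?thesis by blast
  qed
  ultimately have "last_argmax m f k \<in> ?A"
    unfolding last_argmax_def by (rule Max_in)
  then show "last_argmax m f k \<in> {k - m..k}" "\<And>j. j \<in> {k - m..k} \<Longrightarrow> f j \<le> f (last_argmax m f k)"
    by (auto simp: is_arg_max_def not_less)
qed

section \<open>Summability of the gaps between window maxima and function values\<close>

theorem lemma3p6:
  fixes \<Phi> :: "'a::euclidean_space \<Rightarrow> ereal"
    and x :: "nat \<Rightarrow> 'a"
    and m :: nat
    and a b a\<^sub>0 :: real
    and N\<^sub>0 :: "'a set"
    and l :: "nat \<Rightarrow> nat"
    and K\<^sub>1 :: "nat set"
  defines "l \<equiv> last_argmax m (\<lambda>k. \<Phi> (x k))"
    and "K\<^sub>1 \<equiv> {k. \<Phi> (x (l (k + 1))) - \<Phi> (x (k + 1)) \<ge> ereal (a / 2 * (norm (x (k + 1) - x k))\<^sup>2)}"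
  assumes "proper_fun \<Phi>" and "lsc_fun \<Phi>" and "coercive_fun \<Phi>" and "bounded_below_fun \<Phi>"
    and "a > 0" and "b > 0"
    and H1: "\<And>k. \<Phi> (x (k + 1)) + ereal (a * (norm (x (k + 1) - x k))\<^sup>2)
                  \<le> Max ((\<lambda>j. \<Phi> (x j)) ` {k - m..k})"
    and H2: "\<exists>w. \<forall>k. w k \<in> limiting_subdiff \<Phi> (x k) \<and>
                     norm (w (k + 1)) \<le> b * norm (x (k + 1) - x k)"
    and "KL_function \<Phi>"
    and "liminf (\<lambda>k. \<Phi> (x k)) \<ge> lim (\<lambda>k. \<Phi> (x (l k)))"
    and "\<And>r xhat. strict_mono r \<Longrightarrow> (\<lambda>j. x (r j)) \<longlonglongrightarrow> xhat \<Longrightarrow>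
                   limsup (\<lambda>j. \<Phi> (x (r j))) \<le> \<Phi> xhat"
    and "0 \<le> a\<^sub>0" and "a\<^sub>0 \<le> a / (8 * (real m + 1)\<^sup>2)"
    and "cluster_points x \<subseteq> interior N\<^sub>0"
    and "\<And>y z. y \<in> N\<^sub>0 - cluster_points x \<Longrightarrow> z \<in> N\<^sub>0 - cluster_points x \<Longrightarrow>
                 limiting_subdiff \<Phi> z \<noteq> {} \<Longrightarrow>
                 edist 0 (limiting_subdiff \<Phi> z) * ereal (norm (y - z)) + ereal (a\<^sub>0 * (norm (y - z))\<^sup>2)
                   \<ge> \<Phi> z - \<Phi> y"
    and "Liminf (inf sequentially (principal K\<^sub>1))
           (\<lambda>k. if x (k + 1) = x k then \<infinity>
                else (\<Phi> (x (l k)) - \<Phi> (x (l (k + 1)))) / ereal ((norm (x (k + 1) - x k))\<^sup>2)) = 0"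
  shows "(\<lambda>k. sqrt (real_of_ereal (\<Phi> (x (l (k + 1))) - \<Phi> (x (k + 1))))) summable_on K\<^sub>1"
proof -
  note liminf_ge = assms(12) and usc = assms(13) and a0_le = assms(15)
    and nhd = assms(16) and conv = assms(17)
  obtain w where w: "\<And>k. w k \<in> limiting_subdiff \<Phi> (x k)"
      "\<And>k. norm (w (Suc k)) \<le> b * norm (x (Suc k) - x k)"
  proof -
    from H2 obtain w where "\<forall>k. w k \<in> limiting_subdiff \<Phi> (x k) \<and>
        norm (w (k + 1)) \<le> b * norm (x (k + 1) - x k)" ..
    then show ?thesis by (intro that[of w]) simp_all
  qed
  define f where "f k = real_of_ereal (\<Phi> (x k))" for k
  \<comment> \<open>By (H2) every \<open>x k\<close>, including \<open>x 0\<close>, carries a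
    subgradient, so \<Phi> is finite along the sequence.\<close>
  have \<Phi>x: "\<Phi> (x k) = ereal (f k)" for k
  proof -
    have "\<bar>\<Phi> (x k)\<bar> \<noteq> \<infinity>"
      using w(1)[of k] by (simp add: limiting_subdiff_iff_closure)
    then show ?thesis by (simp add: f_def ereal_real')
  qed
  define M where "M k = f (l k)" for k
  define d where "d k = norm (x (Suc k) - x k)" for k
  have d0: "0 \<le> d k" for k by (simp add: d_def)
  have l_ge: "k \<le> l k + m" and l_le: "l k \<le> k" for k
    using last_argmax_window(1)[of m "\<lambda>k. \<Phi> (x k)" k] by (auto simp: l_def)
  have f_le_M: "f j \<le> M k" if "k - m \<le> j" "j \<le> k" for j k
  proof -
    have "\<Phi> (x j) \<le> \<Phi> (x (l k))"
      using last_argmax_window(2)[of j k m "\<lambda>k. \<Phi> (x k)"] that unfolding l_def by simp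
    then show ?thesis by (simp add: M_def \<Phi>x)
  qed
  have descent: "f (Suc k) + a * (d k)\<^sup>2 \<le> M k" for k
  proof -
    have "Max ((\<lambda>j. \<Phi> (x j)) ` {k - m..k}) \<le> ereal (M k)"
      using f_le_M by (intro Max.boundedI) (auto simp: \<Phi>x)
    from order_trans[OF H1 this] show ?thesis by (simp add: \<Phi>x d_def)
  qed
  have dec: "decseq M"
    unfolding decseq_Suc_iff
  proof
    fix k
    show "M (Suc k) \<le> M k"
    \<comment> \<open>Either the new point is the maximizer and descent bounds it by
      \<open>M k\<close>, or the maximizer already lay in the window of \<open>k\<close>.\<close>
    proof (cases "l (Suc k) = Suc k")
      case True
      then show ?thesis
        using descent[of k] \<open>a > 0\<close> by (simp add: M_def) (smt (verit) mult_nonneg_nonneg zero_le_power2)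
    next
      case False
      then show ?thesis
        using f_le_M[of k "l (Suc k)"] l_ge[of "Suc k"] l_le[of "Suc k"] by (simp add: M_def[of "Suc k"])
    qed
  qed
  then have M_mono: "M j \<le> M i" if "i \<le> j" for i j
    using that by (simp add: decseq_def)
  obtain c where "\<And>y. ereal c \<le> \<Phi> y"
    using \<open>bounded_below_fun \<Phi>\<close> by (auto simp: bounded_below_fun_def)
  then have "\<forall>i. c \<le> M i" by (metis M_def \<Phi>x ereal_less_eq(3))
  with dec obtain L where M_lim: "M \<longlonglongrightarrow> L" and L_le_M: "\<And>k. L \<le> M k"
    by (metis decseq_convergent)
  have eM_lim: "(\<lambda>k. ereal (M k)) \<longlonglongrightarrow> ereal L"
    using M_lim by simp
  \<comment> \<open>\<open>M\<close> dominates \<open>f\<close>, so the upper limit is at most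
    \<open>L\<close>; the liminf hypothesis supplies the reverse bound.\<close>
  have \<Phi>_lim: "(\<lambda>k. \<Phi> (x k)) \<longlonglongrightarrow> ereal L"
  proof -
    have "lim (\<lambda>k. \<Phi> (x (l k))) = ereal L"
      using eM_lim by (intro limI) (simp add: \<Phi>x M_def)
    moreover have "limsup (\<lambda>k. \<Phi> (x k)) \<le> limsup (\<lambda>k. ereal (M k))"
      by (intro Limsup_mono always_eventually allI) (simp add: \<Phi>x f_le_M)
    moreover have "limsup (\<lambda>k. ereal (M k)) = ereal L"
      using eM_lim by (intro lim_imp_Limsup) simp_all
    moreover have "liminf (\<lambda>k. \<Phi> (x k)) \<le> limsup (\<lambda>k. \<Phi> (x k))"
      by (intro Liminf_le_Limsup) simp
    ultimately show ?thesis
      using liminf_ge by (subst tendsto_iff_Liminf_eq_Limsup) auto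
  qed
  then have fL: "f \<longlonglongrightarrow> L" by (simp add: \<Phi>x)
  have d_lim: "d \<longlonglongrightarrow> 0"
  proof -
    have "(\<lambda>k. (M k - f (Suc k)) / a) \<longlonglongrightarrow> (L - L) / a"
      using \<open>a > 0\<close> by (intro tendsto_intros M_lim LIMSEQ_Suc fL) simp
    then have lim: "(\<lambda>k. (M k - f (Suc k)) / a) \<longlonglongrightarrow> 0" by simp
    have "(d k)\<^sup>2 \<le> (M k - f (Suc k)) / a" for k
      using descent[of k] \<open>a > 0\<close> by (simp add: pos_le_divide_eq mult.commute)
    then have "(\<lambda>k. (d k)\<^sup>2) \<longlonglongrightarrow> 0"
      by (intro tendsto_sandwich[OF _ _ tendsto_const lim]) simp_all
    then show ?thesis by simp
  qed
  have w_lim: "w \<longlonglongrightarrow> 0"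
  proof -
    have "\<forall>k. norm (w (Suc k)) \<le> b * d k"
      using w(2) unfolding d_def by blast
    moreover have "(\<lambda>k. b * d k) \<longlonglongrightarrow> 0"
      using tendsto_mult_right_zero[OF d_lim] .
    ultimately have "(\<lambda>k. w (Suc k)) \<longlonglongrightarrow> 0"
      by (rule Lim_null_comparison[OF always_eventually])
    then show ?thesis by (rule LIMSEQ_imp_Suc)
  qed
  have bdd: "bounded (range x)"
  proof -
    \<comment> \<open>All iterates lie in the sublevel set of height \<open>M 0\<close>, which
      coercivity makes bounded.\<close>
    have "\<forall>\<^sub>F y in at_infinity. ereal (M 0) < \<Phi> y"
      using \<open>coercive_fun \<Phi>\<close> unfolding coercive_fun_def by (rule order_tendstoD) simp
    then obtain B where B: "\<And>y. B \<le> norm y \<Longrightarrow> ereal (M 0) < \<Phi> y"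
      unfolding eventually_at_infinity by blast
    have "norm (x k) \<le> B" for k
    proof (rule ccontr)
      assume "\<not> ?thesis"
      then have "M 0 < f k" using B[of "x k"] by (simp add: \<Phi>x)
      then show False using f_le_M[of k k] M_mono[of 0 k] by simp
    qed
    then show ?thesis by (auto simp: bounded_iff)
  qed

  \<comment> \<open>Values, criticality and KL inequality on the cluster set\<close>
  define C where "C = cluster_points x"
  have \<Phi>C: "\<Phi> p = ereal L" and critC: "limiting_subdiff \<Phi> p \<noteq> {}" if p: "p \<in> C" for p
  proof -
    obtain r where r: "strict_mono r" "(\<lambda>n. x (r n)) \<longlonglongrightarrow> p"
      using p by (auto simp: C_def cluster_points_def o_def)
    have *: "(\<lambda>n. \<Phi> (x (r n))) \<longlonglongrightarrow> ereal L"
      using LIMSEQ_subseq_LIMSEQ[OF \<Phi>_lim r(1)] by (simp add: o_def)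
    \<comment> \<open>Lower semicontinuity gives this bound, and the limsup hypothesis the opposite
      one.\<close>
    have "\<Phi> p \<le> ereal L"
      using \<open>lsc_fun \<Phi>\<close> r(2) * by (rule lsc_fun_limit_le)
    moreover have "ereal L \<le> \<Phi> p"
      using usc[OF r] lim_imp_Limsup[OF _ *] by simp
    ultimately show eq: "\<Phi> p = ereal L" by simp
    \<comment> \<open>The subgradients \<open>w\<close> vanish along the subsequence, so
      \<open>p\<close> is critical and the KL property is available there.\<close>
    have "0 \<in> limiting_subdiff \<Phi> p"
    proof (rule limiting_subdiff_closed)
      show "w (r n) \<in> limiting_subdiff \<Phi> (x (r n))" for n by (rule w(1))
      show "(\<lambda>n. w (r n)) \<longlonglongrightarrow> 0"
        using LIMSEQ_subseq_LIMSEQ[OF w_lim r(1)] by (simp add: o_def)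
    qed (use eq r * in auto)
    then show "limiting_subdiff \<Phi> p \<noteq> {}" by blast
  qed
  obtain U \<eta> \<psi> D where U: "C \<subseteq> U" and KLb: "KL_bound \<Phi> L U \<eta> \<psi> D"
  proof (rule compact_KL_bound[of C \<Phi> L])
    show "compact C" unfolding C_def using bdd by (rule compact_cluster_points)
    show "KL_property_at \<Phi> p" if "p \<in> C" for p
      using \<open>KL_function \<Phi>\<close> critC[OF that] by (simp add: KL_function_def)
  qed (use \<Phi>C in auto)
  have ev_U: "\<forall>\<^sub>F k in sequentially. x k \<in> U"
    using KLb U by (intro eventually_in_nhd_cluster_points bdd) (auto simp: KL_bound_def C_def)
  have ev_N: "\<forall>\<^sub>F k in sequentially. x k \<in> N\<^sub>0"
    using eventually_in_nhd_cluster_points[OF bdd open_interior nhd]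
    by eventually_elim (use interior_subset in blast)
  have l_lim: "filterlim l at_top sequentially"
    unfolding filterlim_at_top
  proof
    fix Z
    show "\<forall>\<^sub>F k in sequentially. Z \<le> l k"
      using eventually_ge_at_top[of "Z + m"]
    proof eventually_elim
      case (elim k)
      then show ?case using l_ge[of k] by linarith
    qed
  qed

  \<comment> \<open>Summability of the square-root gaps \<open>g\<close>\<close>
  define g where "g k = sqrt (M k - f k)" for k
  have g0: "0 \<le> g k" for k using f_le_M[of k k] by (simp add: g_def)
  have "summable g"
  proof (cases "\<exists>K. M K = L")
    case True
    then obtain K where K: "M K = L" ..
    have MK: "M k = L" if "K \<le> k" for k
      using M_mono[OF that] L_le_M[of k] K by simp
    \<comment> \<open>Equality with \<open>L\<close> travels backwards: descent then leaves no room
      for a step, so \<open>x k = x (k + 1)\<close>.\<close>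
    have f_back: "f k = L" if "K \<le> k" "f (Suc k) = L" for k
    proof -
      have "a * (d k)\<^sup>2 \<le> 0" using descent[of k] MK[OF that(1)] that(2) by simp
      then have "d k = 0" using \<open>a > 0\<close> by (simp add: mult_le_0_iff)
      then show ?thesis using that(2) by (simp add: d_def f_def)
    qed
    have fK: "f k = L" if "K \<le> k" for k
    proof -
      \<comment> \<open>The maximizer \<open>l (k + m)\<close> is an index beyond \<open>k\<close>
        with value \<open>L\<close>, from which the backward induction starts.\<close>
      have "k \<le> l (k + m)" using l_ge[of "k + m"] by simp
      then show ?thesis
      proof (induction rule: inc_induct)
        case base
        then show ?case using MK[of "k + m"] that by (simp add: M_def)
      next
        case (step n)
        then show ?case using f_back that by simp
      qed
    qed
    show ?thesis
      using MK fK by (intro summable_finite[of "{..<K}"]) (auto simp: g_def not_less)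
  next
    case False
    then have M_gt: "L < M k" for k
      using L_le_M[of k] by (metis less_eq_real_def)
    \<comment> \<open>This is the length of the step arriving at \<open>x (l k)\<close>, which
      bounds \<open>w (l k)\<close>. If \<open>l k = 0\<close> the truncated subtraction yields
      \<open>d 0\<close>; the estimates below read \<open>e\<close> as a step length only where
      \<open>l k \<ge> 1\<close>.\<close>
    define e where "e k = d (l k - 1)" for k
    have e0: "0 \<le> e k" for k by (simp add: e_def d0)
    have step: "a * (e (k + (m + 1)))\<^sup>2 \<le> M k - M (k + (m + 1))" for k
    proof -
      \<comment> \<open>The shift \<open>m + 1\<close> places the maximizer strictly after
        \<open>k\<close>, so descent applies at a predecessor \<open>i \<ge> k\<close>.\<close>
      obtain i where i: "l (k + (m + 1)) = Suc i" "k \<le> i"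
        using l_ge[of "k + (m + 1)"] by (cases "l (k + (m + 1))") auto
      have "e (k + (m + 1)) = d i" "M (k + (m + 1)) = f (Suc i)"
        unfolding e_def M_def i(1) by simp_all
      then show ?thesis
        using descent[of i] M_mono[OF i(2)] by simp
    qed
    have w_le: "\<forall>\<^sub>F k in sequentially. norm (w (l k)) \<le> b * e k"
    proof -
      have "\<forall>\<^sub>F k in sequentially. 1 \<le> l k"
        using l_lim by (simp add: filterlim_at_top)
      then show ?thesis
      proof eventually_elim
        case (elim k)
        then show ?case using w(2)[of "l k - 1"] by (simp add: e_def d_def)
      qed
    qed
    have KL_ev: "\<forall>\<^sub>F k in sequentially. 1 \<le> D (M k - L) * (b * e k)"
    proof -
      have "\<forall>\<^sub>F k in sequentially. M k < L + \<eta>"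
        using KLb by (intro order_tendstoD(2)[OF M_lim]) (simp add: KL_bound_def)
      with w_le eventually_compose_filterlim[OF ev_U l_lim] show ?thesis
      proof eventually_elim
        case (elim k)
        have "1 \<le> D (M k - L) * norm (w (l k))"
          using KLb elim M_gt[of k] w(1)[of "l k"] by (auto simp: KL_bound_def \<Phi>x M_def)
        also have "\<dots> \<le> D (M k - L) * (b * e k)"
          using KLb elim M_gt[of k] by (intro mult_left_mono) (auto simp: KL_bound_def)
        finally show ?case .
      qed
    qed
    define s where "s k = sqrt (M k - M (Suc k))" for k
    have se: "summable e" and ss: "summable s"
      unfolding s_def using KLb \<open>a > 0\<close> \<open>b > 0\<close>
      by (intro KL_rate_summable[OF dec M_lim M_gt e0 _ _ step _ _ _ _ KL_ev, where \<eta> = \<eta> and \<psi> = \<psi>];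
          simp add: KL_bound_def)+
    have s0: "0 \<le> s k" for k using M_mono[of k "Suc k"] by (simp add: s_def)
    have sqa: "0 < sqrt a" using \<open>a > 0\<close> by simp
    have d_le: "d k \<le> (s k + g (Suc k)) / sqrt a" for k
    proof -
      \<comment> \<open>The room in the descent condition splits as \<open>M k - f (k + 1) = (M k -
        M (k + 1)) + (M (k + 1) - f (k + 1))\<close>.\<close>
      have "(d k * sqrt a)\<^sup>2 \<le> (s k)\<^sup>2 + (g (Suc k))\<^sup>2"
        using descent[of k] \<open>a > 0\<close> M_mono[of k "Suc k"] f_le_M[of "Suc k" "Suc k"]
        by (simp add: s_def g_def power_mult_distrib mult.commute)
      also have "\<dots> \<le> (s k + g (Suc k))\<^sup>2"
        using s0[of k] g0[of "Suc k"] by (simp add: power2_sum)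
      finally have "d k * sqrt a \<le> s k + g (Suc k)"
        by (rule power2_le_imp_le) (intro add_nonneg_nonneg s0 g0)
      with sqa show ?thesis by (simp add: pos_le_divide_eq)
    qed
    have not_C: "x (l k) \<notin> C" for k
      using \<Phi>C[of "x (l k)"] M_gt[of k] by (auto simp: \<Phi>x M_def)
    have l_dist: "norm (x k - x (l k)) \<le> (\<Sum>j=k-m..<k. d j)" for k
    proof -
      have "norm (x k - x i) \<le> (\<Sum>j=i..<k. d j)" if "i \<le> k" for i
        using that
      proof (induction rule: dec_induct)
        case (step n)
        have "norm (x (Suc n) - x i) \<le> d n + norm (x n - x i)"
          unfolding d_def using norm_triangle_ineq[of "x (Suc n) - x n" "x n - x i"] by simp
        with step show ?case by simp
      qed simp
      from this[OF l_le[of k]] have "norm (x k - x (l k)) \<le> (\<Sum>j=l k..<k. d j)" .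
      also have "\<dots> \<le> (\<Sum>j=k-m..<k. d j)"
        using l_ge[of k] d0 by (intro sum_mono2) auto
      finally show ?thesis .
    qed
    have l_dist_lim: "(\<lambda>k. dist (x (l k)) (x k)) \<longlonglongrightarrow> 0"
    proof (rule tendsto_sandwich[OF always_eventually always_eventually tendsto_const[of 0]])
      \<comment> \<open>Counting backwards from \<open>k\<close> gives a fixed index set, so the
        limit passes termwise. For small \<open>k\<close> truncation repeats terms, which only
        enlarges the sum.\<close>
      show "(\<lambda>k. \<Sum>i\<le>m. d (k - i)) \<longlonglongrightarrow> 0"
        using tendsto_sum[of "{..m}" "\<lambda>i k. d (k - i)" "\<lambda>_. 0" sequentially]
        by (simp add: filterlim_compose[OF d_lim filterlim_minus_const_nat_at_top])
      show "\<forall>k. dist (x (l k)) (x k) \<le> (\<Sum>i\<le>m. d (k - i))"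
      proof
        fix k
        have "dist (x (l k)) (x k) \<le> (\<Sum>j=k-m..<k. d j)"
          using l_dist[of k] by (simp add: dist_norm norm_minus_commute)
        also have "\<dots> \<le> sum d ((\<lambda>i. k - i) ` {..m})"
        proof (rule sum_mono2)
          show "{k - m..<k} \<subseteq> (\<lambda>i. k - i) ` {..m}"
          proof
            fix j assume "j \<in> {k - m..<k}"
            then have "j = k - (k - j)" "k - j \<in> {..m}" by auto
            then show "j \<in> (\<lambda>i. k - i) ` {..m}" by blast
          qed
        qed (use d0 in auto)
        also have "\<dots> \<le> (\<Sum>i\<le>m. d (k - i))"
          using sum_image_le[of "{..m}" d "\<lambda>i. k - i"] d0 by (simp add: o_def)
        finally show "dist (x (l k)) (x k) \<le> (\<Sum>i\<le>m. d (k - i))" .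
      qed
    qed simp
    have near: "f z - \<phi> \<le> norm (w z) * norm (y - x z) + a\<^sub>0 * (norm (y - x z))\<^sup>2"
      if z: "x z \<in> N\<^sub>0" "x z \<notin> C" and y: "y \<in> N\<^sub>0" "y \<notin> C" "\<Phi> y = ereal \<phi>" for z y \<phi>
    proof -
      have "ereal (f z - \<phi>) \<le> edist 0 (limiting_subdiff \<Phi> (x z)) * ereal (norm (y - x z)) + ereal (a\<^sub>0 * (norm (y - x z))\<^sup>2)"
        using conv[of y "x z"] z y w(1)[of z] by (auto simp: C_def \<Phi>x)
      also have "\<dots> \<le> ereal (norm (w z)) * ereal (norm (y - x z)) + ereal (a\<^sub>0 * (norm (y - x z))\<^sup>2)"
        using w(1)[of z] by (intro add_right_mono ereal_mult_right_mono edist_le_norm) auto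
      finally show ?thesis by simp
    qed
    \<comment> \<open>The points \<open>x (l k)\<close> lie outside \<open>C\<close> and accumulate at every point of \<open>C\<close>, so the
        inequality extends to \<open>y \<in> C\<close>, which the assumption excludes.\<close>
    have near_C: "f z - L \<le> norm (w z) * norm (y - x z) + a\<^sub>0 * (norm (y - x z))\<^sup>2"
      if z: "x z \<in> N\<^sub>0" "x z \<notin> C" and y: "y \<in> C" for z y
    proof -
      obtain r where r: "strict_mono r" "(\<lambda>n. x (l (r n))) \<longlonglongrightarrow> y"
        using cluster_point_perturbed[OF l_dist_lim] y unfolding C_def by blast
      have lr: "filterlim (\<lambda>n. l (r n)) at_top sequentially"
        using l_lim filterlim_subseq[OF r(1)] by (rule filterlim_compose)
      have "\<forall>\<^sub>F n in sequentially. f z - f (l (r n)) \<le>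
          norm (w z) * norm (x (l (r n)) - x z) + a\<^sub>0 * (norm (x (l (r n)) - x z))\<^sup>2"
        using eventually_compose_filterlim[OF ev_N lr]
        by eventually_elim (use near[OF z] not_C \<Phi>x in blast)
      moreover have "(\<lambda>n. f z - f (l (r n))) \<longlonglongrightarrow> f z - L"
        by (intro tendsto_intros filterlim_compose[OF fL lr])
      moreover have "(\<lambda>n. norm (w z) * norm (x (l (r n)) - x z) + a\<^sub>0 * (norm (x (l (r n)) - x z))\<^sup>2)
          \<longlonglongrightarrow> norm (w z) * norm (y - x z) + a\<^sub>0 * (norm (y - x z))\<^sup>2"
        by (intro tendsto_intros r(2))
      ultimately show ?thesis
        by (intro tendsto_le[OF trivial_limit_sequentially])
    qed
    \<comment> \<open>\<open>\<rho>\<close> is scaled so that \<open>a\<^sub>0 \<le> \<rho>\<^sup>2 / 8\<close>, and the slack between \<open>\<rho>\<^sup>2 / 8\<close> and \<open>(3 \<rho> / 4)\<^sup>2\<close>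
        leaves room to complete the square in the mixed term.\<close>
    define \<rho> where "\<rho> = sqrt a / (real m + 1)"
    have \<rho>: "0 < \<rho>" using sqa by (simp add: \<rho>_def)
    have a\<^sub>0: "a\<^sub>0 \<le> \<rho>\<^sup>2 / 8"
      using a0_le \<open>a > 0\<close> by (simp add: \<rho>_def power_divide mult.commute)
    \<comment> \<open>This is \<open>3 / 4 * \<rho> / sqrt a\<close>; the factor
      \<open>m + 1\<close> in \<rho> is what ensures \<open>q * m < 3 / 4\<close>.\<close>
    define q where "q = 3 / (4 * (real m + 1))"
    show ?thesis
    proof (rule summable_window[where c = "\<lambda>k. 2 * b / (3 * \<rho>) * e k" and s = s and q = q and m = m])
      show "summable (\<lambda>k. 2 * b / (3 * \<rho>) * e k)" using se by (rule summable_mult)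
      show "0 \<le> 2 * b / (3 * \<rho>) * e k" for k using \<rho> \<open>b > 0\<close> e0 by simp
      show "0 \<le> q" "q * real m < 1" by (simp_all add: q_def field_simps)
      show "\<forall>\<^sub>F k in sequentially. g k \<le> 2 * b / (3 * \<rho>) * e k + q * (\<Sum>j=k-m..<k. s j + g (Suc j))"
        using w_le ev_N eventually_compose_filterlim[OF ev_N l_lim]
      proof eventually_elim
        case (elim k)
        define R where "R = norm (x k - x (l k))"
        have R0: "0 \<le> R" by (simp add: R_def)
        have "(g k)\<^sup>2 \<le> norm (w (l k)) * R + a\<^sub>0 * R\<^sup>2"
        \<comment> \<open>The point \<open>x k\<close> itself may be a cluster point; then
          \<open>f k = L\<close> and the extended inequality applies.\<close>
        proof (cases "x k \<in> C")
          case True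
          then have "f k = L" using \<Phi>C \<Phi>x by fastforce
          then show ?thesis
            using near_C[OF elim(3) not_C True] L_le_M[of k] by (simp add: g_def R_def M_def)
        next
          case False
          then show ?thesis
            using near[OF elim(3) not_C elim(2) False \<Phi>x] f_le_M[of k k] by (simp add: g_def R_def M_def)
        qed
        also have "\<dots> \<le> b * e k * R + \<rho>\<^sup>2 / 8 * R\<^sup>2"
          using elim(1) R0 a\<^sub>0 by (intro add_mono mult_right_mono) auto
        \<comment> \<open>The coefficient \<open>2 * b / (3 * \<rho>)\<close> makes the cross term
          of the square exactly \<open>b * e k * R\<close>, and \<open>9 / 16\<close> exceeds
          \<open>1 / 8\<close>.\<close>
        also have "\<dots> \<le> (2 * b / (3 * \<rho>) * e k + 3 / 4 * \<rho> * R)\<^sup>2"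
        proof -
          have "(2 * b / (3 * \<rho>) * e k + 3 / 4 * \<rho> * R)\<^sup>2
              = (2 * b / (3 * \<rho>) * e k)\<^sup>2 + b * e k * R + 9 / 16 * (\<rho>\<^sup>2 * R\<^sup>2)"
            using \<rho> by (simp add: power2_eq_square field_simps)
          moreover have "0 \<le> (2 * b / (3 * \<rho>) * e k)\<^sup>2" "0 \<le> \<rho>\<^sup>2 * R\<^sup>2" by simp_all
          moreover have "\<rho>\<^sup>2 / 8 * R\<^sup>2 = \<rho>\<^sup>2 * R\<^sup>2 / 8" by simp
          ultimately show ?thesis by linarith
        qed
        finally have "g k \<le> 2 * b / (3 * \<rho>) * e k + 3 / 4 * \<rho> * R"
          by (rule power2_le_imp_le) (use R0 \<rho> e0[of k] \<open>b > 0\<close> in simp)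
        also have "3 / 4 * \<rho> * R \<le> 3 / 4 * \<rho> * ((\<Sum>j=k-m..<k. s j + g (Suc j)) / sqrt a)"
        proof (intro mult_left_mono)
          have "R \<le> (\<Sum>j=k-m..<k. d j)" unfolding R_def by (rule l_dist)
          also have "\<dots> \<le> (\<Sum>j=k-m..<k. (s j + g (Suc j)) / sqrt a)"
            by (intro sum_mono d_le)
          finally show "R \<le> (\<Sum>j=k-m..<k. s j + g (Suc j)) / sqrt a"
            by (simp add: sum_divide_distrib)
        qed (use \<rho> in simp)
        also have "\<dots> = q * (\<Sum>j=k-m..<k. s j + g (Suc j))"
          using sqa by (simp add: q_def \<rho>_def)
        finally show ?case by simp
      qed
    qed (use g0 s0 ss in auto)
  qed
  then have "summable (\<lambda>k. g (Suc k))" by (simp add: summable_Suc_iff)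
  \<comment> \<open>Nonnegativity turns the convergent series into an unconditional sum, which
    restricts to any index subset.\<close>
  then have "(\<lambda>k. g (Suc k)) summable_on UNIV"
    using g0 by (intro summable_nonneg_imp_summable_on) auto
  then have "(\<lambda>k. g (Suc k)) summable_on K\<^sub>1"
    by (rule summable_on_subset_banach) simp
  then show ?thesis by (simp add: g_def M_def \<Phi>x)
qed

end
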